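(* Let $0<\alpha<1$, $\lambda\ge0$, $a>0$, $y_a\in\mathbb{R}$, let $J\subseteq\mathbb{R}$ be an interval and let $f:[0,a]\times J\to\mathbb{R}$ be continuous and satisfy $|f(t,u)-f(t,v)|\le L|u-v|$ for all $t\in[0,a]$, $u,v\in J$, where $0<L<\dfrac{\Gamma(\alpha+1)}{2a^{\alpha}e^{\lambda a}}$. Let $y$ be the unique ($J$-valued) solution of $$\mathbb{D}^{\alpha,\lambda}(y(t))=f(t,y(t)),\ t\in[0,a],\quad e^{\lambda a}y(a)=y_a,$$ and, for $\delta>0$ such that $0<\alpha-\delta<1$, let $z=z_\delta$ be the unique ($J$-valued) solution of $$\mathbb{D}^{\alpha-\delta,\lambda}(z(t))=f(t,z(t)),\ t\in[0,a],\quad e^{\lambda a}z(a)=y_a.$$ Then $\|y-z_\delta\|=\mathcal{O}(\delta)$ as $\delta\to0^+$; that is, there are constants $C>0$ and $\delta_0\in(0,\alpha)$ such that $\|y-z_\delta\|\le C\delta$ for all $\delta\in(0,\delta_0)$.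
   Context: $\|g\|=\max_{t\in[0,a]}|g(t)|$ for $g\in C([0,a])$. For $0<\mu<1$ and $\lambda\ge0$ the (left-sided) Caputo tempered fractional derivative is $$\mathbb{D}^{\mu,\lambda}(y(t))=\frac{e^{-\lambda t}}{\Gamma(1-\mu)}\int_0^t (t-s)^{-\mu}\frac{d}{ds}\left(e^{\lambda s}y(s)\right)ds.$$ Solutions are understood via the equivalent integral equation: a solution of $\mathbb{D}^{\mu,\lambda}(w(t))=f(t,w(t))$ on $[0,a]$ with $e^{\lambda a}w(a)=y_a$ is a continuous function $w:[0,a]\to J$ such that for all $t\in[0,a]$ $$w(t)=y_a e^{-\lambda t}-\frac{e^{-\lambda t}}{\Gamma(\mu)}\int_0^a e^{\lambda s}(a-s)^{\mu-1}f(s,w(s))\,ds+\frac{e^{-\lambda t}}{\Gamma(\mu)}\int_0^t e^{\lambda s}(t-s)^{\mu-1}f(s,w(s))\,ds.$$ The unique solutions $y$ and $z_\delta$ are assumed to exist (for all sufficiently small $\delta$ in the case of $z_\delta$). *)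

theory Defs
  imports "HOL-Analysis.Analysis"
begin

(* The maximum norm on C([0,a]); for continuous g the supremum is attained. *)
definition max_norm :: "real \<Rightarrow> (real \<Rightarrow> real) \<Rightarrow> real" where
  "max_norm a g = (SUP t\<in>{0..a}. \<bar>g t\<bar>)"

(* Solutions of the terminal value problem
     D^{\<mu>,lam} w(t) = f(t, w(t)) on [0,a],   e^{lam a} w(a) = y_a,
   for the Caputo tempered fractional derivative
     D^{\<mu>,lam} w(t) = e^{-lam t} / \<Gamma>(1-\<mu>) * \<integral>_0^t (t-s)^{-\<mu>} (d/ds) (e^{lam s} w(s)) ds,   0 < \<mu> < 1,
   are by definition the continuous J-valued solutions of the equivalent integral equation.
   The terminal condition is that equation at t = a.  Values of w outside [0,a] play no role.
   Since 0 powr x = 0, the integrands vanish, instead of being singular, at the single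
   points s = a and s = t, which does not affect the integrals. *)
definition caputo_tempered_solution ::
  "real \<Rightarrow> real \<Rightarrow> real \<Rightarrow> real \<Rightarrow> real set \<Rightarrow> (real \<Rightarrow> real \<Rightarrow> real) \<Rightarrow> (real \<Rightarrow> real) \<Rightarrow> bool"
where
  "caputo_tempered_solution \<mu> lam a y\<^sub>a J f w \<longleftrightarrow>
     continuous_on {0..a} w \<and> w ` {0..a} \<subseteq> J \<and>
     (\<forall>t\<in>{0..a}.
        w t = y\<^sub>a * exp (- lam * t)
          - exp (- lam * t) / Gamma \<mu> *
              integral {0..a} (\<lambda>s. exp (lam * s) * (a - s) powr (\<mu> - 1) * f s (w s))
          + exp (- lam * t) / Gamma \<mu> *
              integral {0..t} (\<lambda>s. exp (lam * s) * (t - s) powr (\<mu> - 1) * f s (w s)))"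

definition unique_caputo_tempered_solution ::
  "real \<Rightarrow> real \<Rightarrow> real \<Rightarrow> real \<Rightarrow> real set \<Rightarrow> (real \<Rightarrow> real \<Rightarrow> real) \<Rightarrow> (real \<Rightarrow> real) \<Rightarrow> bool"
where
  "unique_caputo_tempered_solution \<mu> lam a y\<^sub>a J f w \<longleftrightarrow>
     caputo_tempered_solution \<mu> lam a y\<^sub>a J f w \<and>
     (\<forall>v. caputo_tempered_solution \<mu> lam a y\<^sub>a J f v \<longrightarrow> (\<forall>t\<in>{0..a}. v t = w t))"

end

(* With the kernel k_mu(r) = r^(mu-1) / Gamma(mu), the integral equations for y (order alpha) and z
   (order beta = alpha - delta) are subtracted, and the integrands are split as
     k_alpha g - k_beta h = g (k_alpha - k_beta) + (g - h) k_beta.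
   This gives
     ||y - z|| <= A ||k_alpha - k_beta||_1 + 2 e^(lam a) L a^beta / Gamma(beta+1) ||y - z||.
   By the bound on L, the last coefficient is below some q < 1 for small delta, so the last term is
   absorbed on the left, and ||k_alpha - k_beta||_1 = O(delta). *)

theory Submission
  imports Defs
begin

section \<open>The Riemann-Liouville kernel and convolutions with it\<close>

text \<open>Writing 1/Gamma as \<open>rGamma\<close> makes the normalisation an entire function of
  the order, so its continuity and differentiability in \<mu> are directly available.\<close>

definition rl_kernel :: "real \<Rightarrow> real \<Rightarrow> real" where
  "rl_kernel \<mu> r = rGamma \<mu> * r powr (\<mu> - 1)"

lemma rGamma_pos: "0 < (x::real) \<Longrightarrow> 0 < rGamma x"
  by (simp add: rGamma_inverse_Gamma Gamma_real_pos)

lemma rl_kernel_nonneg: "0 < \<mu> \<Longrightarrow> 0 \<le> rl_kernel \<mu> r"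
  by (simp add: rl_kernel_def rGamma_pos less_imp_le)

lemma rl_kernel_has_integral:
  assumes "0 < \<mu>" "0 \<le> t"
  shows "(rl_kernel \<mu> has_integral t powr \<mu> * rGamma (\<mu> + 1)) {0..t}"
proof -
  have "((\<lambda>r. rGamma \<mu> * r powr (\<mu> - 1)) has_integral rGamma \<mu> * (t powr \<mu> / \<mu>)) {0..t}"
    using has_integral_powr_from_0[of "\<mu> - 1" t] assms
    by (intro has_integral_mult_right) simp
  moreover have "rGamma \<mu> * (t powr \<mu> / \<mu>) = t powr \<mu> * rGamma (\<mu> + 1)"
    using rGamma_plus1[of \<mu>] assms by (simp add: field_simps)
  ultimately show ?thesis
    unfolding rl_kernel_def by metis
qed

lemma rl_kernel_absolutely_integrable:
  assumes "0 < \<mu>" "0 \<le> t"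
  shows "rl_kernel \<mu> absolutely_integrable_on {0..t}"
  using rl_kernel_has_integral[OF assms] rl_kernel_nonneg[OF assms(1)]
  by (intro nonnegative_absolutely_integrable_1) auto

text \<open>The affine change of variables of slope -1 maps \<open>{0..t}\<close> onto itself. It
  transfers integrals of the kernel in r to the convolution variable s, where r = t - s.\<close>

lemma has_integral_reflect_0:
  fixes g :: "real \<Rightarrow> 'b::banach"
  assumes "(g has_integral i) {0..t}"
  shows "((\<lambda>s. g (t - s)) has_integral i) {0..t}"
proof -
  have "((\<lambda>s. g ((-1) *\<^sub>R s + t)) has_integral (1 / \<bar>-1\<bar> ^ DIM(real)) *\<^sub>R i)
      ((\<lambda>s. (1 / (-1)) *\<^sub>R s + - ((1 / (-1)) *\<^sub>R t)) ` cbox 0 t)"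
    by (rule has_integral_affinity) (use assms in auto)
  moreover have "(\<lambda>s. (1 / (-1)) *\<^sub>R s + - ((1 / (-1)) *\<^sub>R t)) ` cbox 0 t = {0..t}"
    using image_diff_atLeastAtMost[of t 0 t] by simp
  ultimately show ?thesis
    by (simp add: algebra_simps)
qed

text \<open>The kernel may be unbounded near s = t, so continuity alone does not give integrability.
  Being nonnegative, the kernel is absolutely integrable, and a bounded measurable factor preserves
  this.\<close>

lemma rl_convolution_integrable:
  assumes "0 < \<mu>" "0 \<le> t" "continuous_on {0..t} g"
  shows "(\<lambda>s. g s * rl_kernel \<mu> (t - s)) integrable_on {0..t}"
proof -
  have "(\<lambda>s. rl_kernel \<mu> (t - s)) absolutely_integrable_on {0..t}"
    using has_integral_reflect_0[OF rl_kernel_has_integral[OF assms(1,2)]] rl_kernel_nonneg[OF assms(1)]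
    by (intro nonnegative_absolutely_integrable_1) auto
  moreover have "bounded (g ` {0..t})"
    using assms(3) by (intro compact_imp_bounded compact_continuous_image) auto
  ultimately have "(\<lambda>s. g s * rl_kernel \<mu> (t - s)) absolutely_integrable_on {0..t}"
    using assms(3)
    by (intro absolutely_integrable_bounded_measurable_product_real
        continuous_imp_measurable_on_sets_lebesgue) auto
  then show ?thesis
    by (rule absolutely_integrable_on_def[THEN iffD1, THEN conjunct1])
qed

lemma rl_kernel_diff_integrable:
  assumes "0 < \<alpha>" "0 < \<beta>" "0 \<le> a"
  shows "(\<lambda>r. \<bar>rl_kernel \<alpha> r - rl_kernel \<beta> r\<bar>) integrable_on {0..a}"
proof -
  have "(\<lambda>r. rl_kernel \<alpha> r - rl_kernel \<beta> r) absolutely_integrable_on {0..a}"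
    using assms by (intro set_integral_diff rl_kernel_absolutely_integrable)
  then show ?thesis
    unfolding absolutely_integrable_on_def real_norm_def by blast
qed

text \<open>The splitting pairs the kernel difference with g and the difference g - h with the
  kernel of order \<beta>. Hence a bound M is required for g only, and h enters only through its
  distance N from g.\<close>

lemma rl_convolution_diff_bound:
  assumes "0 < \<alpha>" "0 < \<beta>" "0 \<le> t" "t \<le> a"
    and cont: "continuous_on {0..t} g" "continuous_on {0..t} h"
    and M: "\<And>s. s \<in> {0..t} \<Longrightarrow> \<bar>g s\<bar> \<le> M"
    and N: "\<And>s. s \<in> {0..t} \<Longrightarrow> \<bar>g s - h s\<bar> \<le> N"
  shows "\<bar>integral {0..t} (\<lambda>s. g s * rl_kernel \<alpha> (t - s)) - integral {0..t} (\<lambda>s. h s * rl_kernel \<beta> (t - s))\<bar>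
    \<le> M * integral {0..a} (\<lambda>r. \<bar>rl_kernel \<alpha> r - rl_kernel \<beta> r\<bar>) + N * (a powr \<beta> * rGamma (\<beta> + 1))"
proof -
  let ?k = "\<lambda>r. \<bar>rl_kernel \<alpha> r - rl_kernel \<beta> r\<bar>"
  have nonneg: "0 \<le> M" "0 \<le> N"
    using M[of 0] N[of 0] \<open>0 \<le> t\<close> by auto
  have D: "((\<lambda>s. M * ?k (t - s) + N * rl_kernel \<beta> (t - s)) has_integral
      M * integral {0..t} ?k + N * (t powr \<beta> * rGamma (\<beta> + 1))) {0..t}"
    using assms(1-3)
    by (intro has_integral_add has_integral_mult_right has_integral_reflect_0
        integrable_integral rl_kernel_diff_integrable rl_kernel_has_integral)
      (auto intro!: has_integral_reflect_0[of ?k] integrable_integral rl_kernel_diff_integrable)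
  have int: "(\<lambda>s. g s * rl_kernel \<alpha> (t - s)) integrable_on {0..t}"
    "(\<lambda>s. h s * rl_kernel \<beta> (t - s)) integrable_on {0..t}"
    using assms by (intro rl_convolution_integrable; simp)+
  have "norm (integral {0..t} (\<lambda>s. g s * rl_kernel \<alpha> (t - s) - h s * rl_kernel \<beta> (t - s)))
      \<le> integral {0..t} (\<lambda>s. M * ?k (t - s) + N * rl_kernel \<beta> (t - s))"
  proof (rule integral_norm_bound_integral)
    fix s assume s: "s \<in> {0..t}"
    have "g s * rl_kernel \<alpha> (t - s) - h s * rl_kernel \<beta> (t - s) =
        g s * (rl_kernel \<alpha> (t - s) - rl_kernel \<beta> (t - s)) + (g s - h s) * rl_kernel \<beta> (t - s)"
      by (simp add: algebra_simps)
    also have "norm \<dots> \<le> \<bar>g s\<bar> * ?k (t - s) + \<bar>g s - h s\<bar> * rl_kernel \<beta> (t - s)"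
      using rl_kernel_nonneg[OF \<open>0 < \<beta>\<close>, of "t - s"]
      by (metis abs_mult abs_of_nonneg abs_triangle_ineq real_norm_def)
    also have "\<dots> \<le> M * ?k (t - s) + N * rl_kernel \<beta> (t - s)"
      using M[OF s] N[OF s] rl_kernel_nonneg[OF \<open>0 < \<beta>\<close>] by (intro add_mono mult_right_mono) auto
    finally show "norm (g s * rl_kernel \<alpha> (t - s) - h s * rl_kernel \<beta> (t - s)) \<le> \<dots>" .
  qed (use int D in \<open>auto intro: integrable_diff\<close>)
  also have "\<dots> = M * integral {0..t} ?k + N * (t powr \<beta> * rGamma (\<beta> + 1))"
    using D by (rule integral_unique)
  \<comment> \<open>Both integrands are nonnegative, so passing from t to a only enlarges the bound
    and makes it uniform in t.\<close>
  also have "\<dots> \<le> M * integral {0..a} ?k + N * (a powr \<beta> * rGamma (\<beta> + 1))"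
    using assms(1-4) nonneg
    by (intro add_mono mult_left_mono mult_right_mono integral_subset_le rl_kernel_diff_integrable powr_mono2)
      (auto simp: rGamma_pos less_imp_le)
  finally show ?thesis
    using int by (simp add: integral_diff)
qed

section \<open>The L1 distance between kernels of nearby orders\<close>

text \<open>Up to a term of order \<open>\<alpha> - \<beta>\<close>, the difference of powers is bounded by itself without the
  absolute value, so that its integral is explicit and no logarithm has to be integrated.\<close>

lemma powr_diff_bound:
  fixes \<alpha> \<beta> r :: real
  assumes "\<beta> \<le> \<alpha>" "0 \<le> r"
  shows "\<bar>r powr (\<alpha> - 1) - r powr (\<beta> - 1)\<bar> \<le> r powr (\<beta> - 1) - r powr (\<alpha> - 1) + 2 * (\<alpha> - \<beta>) * r powr \<alpha>"
proof (cases "r \<le> 1")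
  case True
  \<comment> \<open>On this range the difference has a known sign, and the correction term is just
    nonnegative slack.\<close>
  then have "r powr (\<alpha> - 1) \<le> r powr (\<beta> - 1)"
    using assms by (intro powr_mono') auto
  then show ?thesis
    using assms by simp
next
  case False
  then have "r > 1" by simp
  \<comment> \<open>Here the sign is reversed. From exp u \<ge> 1 + u and ln r \<le> r, the
    nonnegative number x = r^(\<alpha>-1) - r^(\<beta>-1) is at most (\<alpha> - \<beta>)
    r^\<alpha>. The factor 2 in the claim comes from x = -x + 2x.\<close>
  have "1 - (\<alpha> - \<beta>) * ln r \<le> r powr (\<beta> - \<alpha>)"
    using exp_ge_add_one_self[of "(\<beta> - \<alpha>) * ln r"] \<open>r > 1\<close> by (simp add: powr_def algebra_simps)
  moreover have "(\<alpha> - \<beta>) * ln r \<le> (\<alpha> - \<beta>) * r"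
    using ln_bound[of r] \<open>r > 1\<close> assms by (intro mult_left_mono) auto
  ultimately have "r powr (\<alpha> - 1) * (1 - r powr (\<beta> - \<alpha>)) \<le> r powr (\<alpha> - 1) * ((\<alpha> - \<beta>) * r)"
    by (intro mult_left_mono) auto
  moreover have "r powr (\<alpha> - 1) * r powr (\<beta> - \<alpha>) = r powr (\<beta> - 1)"
    by (simp flip: powr_add)
  moreover have "r powr (\<alpha> - 1) * r = r powr \<alpha>"
    using \<open>r > 1\<close> by (simp add: powr_diff)
  ultimately have "r powr (\<alpha> - 1) - r powr (\<beta> - 1) \<le> (\<alpha> - \<beta>) * r powr \<alpha>"
    by (simp add: algebra_simps)
  moreover have "r powr (\<beta> - 1) \<le> r powr (\<alpha> - 1)"
    using \<open>r > 1\<close> assms by (intro powr_mono) auto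
  ultimately show ?thesis
    unfolding mult.assoc[of 2] by linarith
qed

text \<open>The kernel difference is separated into a change of the normalising factor and a change
  of the exponent. With \<open>powr_diff_bound\<close>, the resulting majorant is a combination of
  powers, which integrate explicitly.\<close>

lemma rl_kernel_diff_integral_le:
  assumes "0 < \<beta>" "\<beta> \<le> \<alpha>" "0 \<le> a"
  shows "integral {0..a} (\<lambda>r. \<bar>rl_kernel \<alpha> r - rl_kernel \<beta> r\<bar>) \<le>
    \<bar>rGamma \<alpha> - rGamma \<beta>\<bar> * (a powr \<alpha> / \<alpha>) +
    rGamma \<beta> * (a powr \<beta> / \<beta> - a powr \<alpha> / \<alpha> + 2 * (\<alpha> - \<beta>) * (a powr (\<alpha> + 1) / (\<alpha> + 1)))"
proof (rule has_integral_le)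
  have powr: "((\<lambda>r. r powr (\<mu> - 1)) has_integral a powr \<mu> / \<mu>) {0..a}" if "0 < \<mu>" for \<mu>
    using has_integral_powr_from_0[of "\<mu> - 1" a] that \<open>0 \<le> a\<close> by simp
  show "((\<lambda>r. \<bar>rGamma \<alpha> - rGamma \<beta>\<bar> * r powr (\<alpha> - 1) +
      rGamma \<beta> * (r powr (\<beta> - 1) - r powr (\<alpha> - 1) + 2 * (\<alpha> - \<beta>) * r powr \<alpha>)) has_integral
    \<bar>rGamma \<alpha> - rGamma \<beta>\<bar> * (a powr \<alpha> / \<alpha>) +
    rGamma \<beta> * (a powr \<beta> / \<beta> - a powr \<alpha> / \<alpha> + 2 * (\<alpha> - \<beta>) * (a powr (\<alpha> + 1) / (\<alpha> + 1)))) {0..a}"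
    using assms
    by (intro has_integral_add has_integral_diff has_integral_mult_right powr has_integral_powr_from_0) auto
  show "((\<lambda>r. \<bar>rl_kernel \<alpha> r - rl_kernel \<beta> r\<bar>) has_integral
      integral {0..a} (\<lambda>r. \<bar>rl_kernel \<alpha> r - rl_kernel \<beta> r\<bar>)) {0..a}"
    using assms by (intro integrable_integral rl_kernel_diff_integrable) auto
next
  fix r assume r: "r \<in> {0..a}"
  have "rl_kernel \<alpha> r - rl_kernel \<beta> r = (rGamma \<alpha> - rGamma \<beta>) * r powr (\<alpha> - 1) +
      rGamma \<beta> * (r powr (\<alpha> - 1) - r powr (\<beta> - 1))"
    by (simp add: rl_kernel_def algebra_simps)
  then have "\<bar>rl_kernel \<alpha> r - rl_kernel \<beta> r\<bar> \<le> \<bar>rGamma \<alpha> - rGamma \<beta>\<bar> * r powr (\<alpha> - 1) +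
      rGamma \<beta> * \<bar>r powr (\<alpha> - 1) - r powr (\<beta> - 1)\<bar>"
    using rGamma_pos[OF \<open>0 < \<beta>\<close>]
    by (metis abs_mult abs_of_pos abs_triangle_ineq powr_ge_zero abs_of_nonneg)
  also have "\<dots> \<le> \<bar>rGamma \<alpha> - rGamma \<beta>\<bar> * r powr (\<alpha> - 1) +
      rGamma \<beta> * (r powr (\<beta> - 1) - r powr (\<alpha> - 1) + 2 * (\<alpha> - \<beta>) * r powr \<alpha>)"
    using rGamma_pos[OF \<open>0 < \<beta>\<close>] r assms
    by (intro add_left_mono mult_left_mono powr_diff_bound) auto
  finally show "\<bar>rl_kernel \<alpha> r - rl_kernel \<beta> r\<bar> \<le> \<dots>" .
qed

lemma tendsto_minus_at_right_0:
  "((\<lambda>\<delta>. x - \<delta>) \<longlongrightarrow> (x::real)) (at_right 0)"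
  by (rule tendsto_eq_intros refl | simp)+

text \<open>The difference quotient converges, hence is bounded near 0. The shift is x - \<delta>
  because the perturbed order approaches \<alpha> from below.\<close>

lemma differentiable_imp_linear_bound:
  fixes g :: "real \<Rightarrow> real"
  assumes "(g has_real_derivative d) (at x)"
  shows "\<exists>C\<ge>0. \<forall>\<^sub>F \<delta> in at_right 0. \<bar>g x - g (x - \<delta>)\<bar> \<le> C * \<delta>"
proof -
  have "((\<lambda>\<delta>. g (x - \<delta>)) has_real_derivative d * (0 - 1)) (at 0)"
    by (rule DERIV_chain'[where g = g]) (auto intro!: derivative_eq_intros assms)
  then have "((\<lambda>\<delta>. (g (x - \<delta>) - g x) / \<delta>) \<longlongrightarrow> - d) (at_right 0)"
    unfolding has_field_derivative_iff by (auto intro: filterlim_at_split[THEN iffD1, THEN conjunct2])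
  then have "((\<lambda>\<delta>. \<bar>(g (x - \<delta>) - g x) / \<delta>\<bar>) \<longlongrightarrow> \<bar>- d\<bar>) (at_right 0)"
    by (rule tendsto_rabs)
  \<comment> \<open>Any constant above the limit |d| would serve; |d| + 1 is one.\<close>
  then have "\<forall>\<^sub>F \<delta> in at_right 0. \<bar>(g (x - \<delta>) - g x) / \<delta>\<bar> < \<bar>d\<bar> + 1"
    by (rule order_tendstoD) simp
  then have "\<forall>\<^sub>F \<delta> in at_right 0. \<bar>g x - g (x - \<delta>)\<bar> \<le> (\<bar>d\<bar> + 1) * \<delta>"
    using eventually_at_right_less[of 0]
    by eventually_elim (auto simp: abs_divide field_simps abs_minus_commute)
  then show ?thesis
    by (intro exI[of _ "\<bar>d\<bar> + 1"]) simp
qed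

text \<open>The explicit bound of \<open>rl_kernel_diff_integral_le\<close> vanishes at \<delta> =
  0. Apart from a term already linear in \<delta>, its small factors are increments of
  \<open>rGamma\<close> and of x -> a^x / x, both differentiable at \<alpha>.\<close>

lemma rl_kernel_diff_linear_bound:
  assumes "0 < \<alpha>" "0 < a"
  shows "\<exists>C\<ge>0. \<forall>\<^sub>F \<delta> in at_right 0.
    integral {0..a} (\<lambda>r. \<bar>rl_kernel \<alpha> r - rl_kernel (\<alpha> - \<delta>) r\<bar>) \<le> C * \<delta>"
proof -
  have "\<alpha> \<notin> \<int>\<^sub>\<le>\<^sub>0"
    using \<open>0 < \<alpha>\<close> by (auto elim!: nonpos_Ints_cases)
  then have "(rGamma has_real_derivative - rGamma \<alpha> * Digamma \<alpha>) (at \<alpha>)"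
    by (rule has_field_derivative_rGamma_no_nonpos_int)
  from differentiable_imp_linear_bound[OF this] obtain C1 where C1: "C1 \<ge> 0"
    "\<forall>\<^sub>F \<delta> in at_right 0. \<bar>rGamma \<alpha> - rGamma (\<alpha> - \<delta>)\<bar> \<le> C1 * \<delta>" by auto
  have "((\<lambda>x. a powr x / x) has_real_derivative
      (a powr \<alpha> * ln a * \<alpha> - a powr \<alpha>) / (\<alpha> * \<alpha>)) (at \<alpha>)"
    using assms by (auto intro!: derivative_eq_intros)
  from differentiable_imp_linear_bound[OF this] obtain C2 where C2: "C2 \<ge> 0"
    "\<forall>\<^sub>F \<delta> in at_right 0. \<bar>a powr \<alpha> / \<alpha> - a powr (\<alpha> - \<delta>) / (\<alpha> - \<delta>)\<bar> \<le> C2 * \<delta>" by auto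
  have "((\<lambda>\<delta>. rGamma (\<alpha> - \<delta>)) \<longlongrightarrow> rGamma \<alpha>) (at_right 0)"
    by (rule isCont_tendsto_compose[OF isCont_rGamma tendsto_minus_at_right_0]) simp
  \<comment> \<open>Continuity caps the prefactor \<open>rGamma (\<alpha> - \<delta>)\<close> by a
    constant independent of \<delta>.\<close>
  then have ev: "\<forall>\<^sub>F \<delta> in at_right 0. rGamma (\<alpha> - \<delta>) < rGamma \<alpha> + 1"
    by (rule order_tendstoD) simp
  have ev_pos: "\<forall>\<^sub>F \<delta> in at_right 0. 0 < \<alpha> - \<delta>"
    using tendsto_minus_at_right_0 \<open>0 < \<alpha>\<close> by (rule order_tendstoD)
  define A where "A = a powr \<alpha> / \<alpha>"
  define B where "B = a powr (\<alpha> + 1) / (\<alpha> + 1)"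
  have AB: "0 \<le> A" "0 \<le> B"
    using assms by (auto simp: A_def B_def)
  have g: "0 < rGamma \<alpha>"
    using assms by (simp add: rGamma_pos)
  show ?thesis
  proof (intro exI conjI)
    show "0 \<le> C1 * A + (rGamma \<alpha> + 1) * (C2 + 2 * B)"
      using C1(1) C2(1) AB g by simp
    show "\<forall>\<^sub>F \<delta> in at_right 0. integral {0..a} (\<lambda>r. \<bar>rl_kernel \<alpha> r - rl_kernel (\<alpha> - \<delta>) r\<bar>)
        \<le> (C1 * A + (rGamma \<alpha> + 1) * (C2 + 2 * B)) * \<delta>"
      using C1(2) C2(2) ev ev_pos eventually_at_right_less[of 0]
    proof eventually_elim
      case (elim \<delta>)
      have "integral {0..a} (\<lambda>r. \<bar>rl_kernel \<alpha> r - rl_kernel (\<alpha> - \<delta>) r\<bar>) \<le>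
          \<bar>rGamma \<alpha> - rGamma (\<alpha> - \<delta>)\<bar> * A +
          rGamma (\<alpha> - \<delta>) * (a powr (\<alpha> - \<delta>) / (\<alpha> - \<delta>) - A + 2 * \<delta> * B)"
        using rl_kernel_diff_integral_le[of "\<alpha> - \<delta>" \<alpha> a] elim assms by (simp add: A_def B_def)
      also have "\<dots> \<le> (C1 * \<delta>) * A + rGamma (\<alpha> - \<delta>) * (C2 * \<delta> + 2 * \<delta> * B)"
        using elim AB rGamma_pos[of "\<alpha> - \<delta>"]
        by (intro add_mono mult_right_mono mult_left_mono) (auto simp: A_def)
      also have "\<dots> \<le> (C1 * \<delta>) * A + (rGamma \<alpha> + 1) * (C2 * \<delta> + 2 * \<delta> * B)"
        using elim AB C2(1) by (intro add_mono mult_right_mono) auto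
      finally show ?case by (simp add: algebra_simps)
    qed
  qed
qed

section \<open>From the integral equation to a max-norm estimate\<close>

text \<open>Absorbing the tempering weight exp(lam s) into the source and 1/Gamma into the kernel
  leaves two ordinary convolutions, at a and at t, to which \<open>rl_convolution_diff_bound\<close>
  applies.\<close>

lemma caputo_tempered_solution_rl:
  assumes "caputo_tempered_solution \<mu> lam a y\<^sub>a J f w" "t \<in> {0..a}"
  shows "w t = exp (- lam * t) * (y\<^sub>a
    - integral {0..a} (\<lambda>s. (exp (lam * s) * f s (w s)) * rl_kernel \<mu> (a - s))
    + integral {0..t} (\<lambda>s. (exp (lam * s) * f s (w s)) * rl_kernel \<mu> (t - s)))"
proof -
  have rl: "integral {0..u} (\<lambda>s. (exp (lam * s) * f s (w s)) * rl_kernel \<mu> (u - s)) =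
      rGamma \<mu> * integral {0..u} (\<lambda>s. exp (lam * s) * (u - s) powr (\<mu> - 1) * f s (w s))" for u
    unfolding integral_mult_right[symmetric]
    by (rule integral_cong) (simp add: rl_kernel_def algebra_simps)
  have "w t = y\<^sub>a * exp (- lam * t)
      - exp (- lam * t) / Gamma \<mu> * integral {0..a} (\<lambda>s. exp (lam * s) * (a - s) powr (\<mu> - 1) * f s (w s))
      + exp (- lam * t) / Gamma \<mu> * integral {0..t} (\<lambda>s. exp (lam * s) * (t - s) powr (\<mu> - 1) * f s (w s))"
    using assms unfolding caputo_tempered_solution_def by blast
  then show ?thesis
    unfolding rl rGamma_inverse_Gamma divide_inverse by (simp only: algebra_simps)
qed

lemma abs_le_max_norm:
  assumes "continuous_on {0..a} g" "t \<in> {0..a}"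
  shows "\<bar>g t\<bar> \<le> max_norm a g"
  unfolding max_norm_def
proof (rule cSUP_upper[OF assms(2)])
  have "compact ((\<lambda>t. \<bar>g t\<bar>) ` {0..a})"
    using assms(1) by (intro compact_continuous_image continuous_intros) auto
  then show "bdd_above ((\<lambda>t. \<bar>g t\<bar>) ` {0..a})"
    by (intro bounded_imp_bdd_above compact_imp_bounded)
qed

lemma max_norm_le:
  assumes "0 \<le> a" "\<And>t. t \<in> {0..a} \<Longrightarrow> \<bar>g t\<bar> \<le> c"
  shows "max_norm a g \<le> c"
  unfolding max_norm_def using assms by (intro cSUP_least) auto

text \<open>The factor 2 arises because the convolutions at t and at a each contribute the same
  bound. M controls f along w alone, so no bound uniform in the order is needed along v.\<close>

lemma caputo_tempered_solution_max_norm_diff: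
  assumes "0 < \<alpha>" "0 < \<beta>" "0 \<le> lam" "0 < a"
    and f: "continuous_on ({0..a} \<times> J) (\<lambda>(t, u). f t u)"
    and L: "\<And>t u v. t \<in> {0..a} \<Longrightarrow> u \<in> J \<Longrightarrow> v \<in> J \<Longrightarrow> \<bar>f t u - f t v\<bar> \<le> L * \<bar>u - v\<bar>"
    and "0 \<le> L"
    and M: "\<And>s. s \<in> {0..a} \<Longrightarrow> \<bar>f s (w s)\<bar> \<le> M"
    and w: "caputo_tempered_solution \<alpha> lam a y\<^sub>a J f w"
    and v: "caputo_tempered_solution \<beta> lam a y\<^sub>a J f v"
  shows "max_norm a (\<lambda>t. w t - v t) \<le>
    2 * exp (lam * a) * M * integral {0..a} (\<lambda>r. \<bar>rl_kernel \<alpha> r - rl_kernel \<beta> r\<bar>)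
    + 2 * exp (lam * a) * L * (a powr \<beta> * rGamma (\<beta> + 1)) * max_norm a (\<lambda>t. w t - v t)"
proof -
  let ?N = "max_norm a (\<lambda>t. w t - v t)"
  let ?g = "\<lambda>x s. exp (lam * s) * f s (x s)"
  let ?I = "\<lambda>\<mu> x t. integral {0..t} (\<lambda>s. ?g x s * rl_kernel \<mu> (t - s))"
  let ?B = "exp (lam * a) * M * integral {0..a} (\<lambda>r. \<bar>rl_kernel \<alpha> r - rl_kernel \<beta> r\<bar>)
      + exp (lam * a) * (L * ?N) * (a powr \<beta> * rGamma (\<beta> + 1))"
  have wv: "continuous_on {0..a} w" "w ` {0..a} \<subseteq> J" "continuous_on {0..a} v" "v ` {0..a} \<subseteq> J"
    using w v by (auto simp: caputo_tempered_solution_def)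
  have cont: "continuous_on {0..a} (?g x)"
    if "continuous_on {0..a} x" "x ` {0..a} \<subseteq> J" for x
  proof -
    have "continuous_on {0..a} (\<lambda>s. (\<lambda>(t, u). f t u) (s, x s))"
      using that by (intro continuous_on_compose2[OF f] continuous_intros) auto
    then show ?thesis
      by (intro continuous_intros) simp
  qed
  have E: "exp (lam * s) \<le> exp (lam * a)" if "s \<in> {0..a}" for s
    using that \<open>0 \<le> lam\<close> by (simp add: mult_left_mono)
  have I: "\<bar>?I \<alpha> w t - ?I \<beta> v t\<bar> \<le> ?B" if t: "t \<in> {0..a}" for t
  proof (rule rl_convolution_diff_bound)
    fix s assume "s \<in> {0..t}"
    with t have s: "s \<in> {0..a}" by auto
    show "\<bar>?g w s\<bar> \<le> exp (lam * a) * M"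
      unfolding abs_mult using E[OF s] M[OF s] by (intro mult_mono) auto
    have "\<bar>f s (w s) - f s (v s)\<bar> \<le> L * \<bar>w s - v s\<bar>"
      using s wv by (intro L) auto
    also have "\<dots> \<le> L * ?N"
      using s wv \<open>0 \<le> L\<close>
      by (intro mult_left_mono abs_le_max_norm[where g = "\<lambda>t. w t - v t"] continuous_intros) auto
    finally show "\<bar>?g w s - ?g v s\<bar> \<le> exp (lam * a) * (L * ?N)"
      unfolding right_diff_distrib[symmetric] abs_mult using E[OF s] by (intro mult_mono) auto
  qed (use t assms wv in \<open>auto intro: continuous_on_subset[OF cont]\<close>)
  have "?N \<le> 2 * ?B"
  proof (rule max_norm_le)
    fix t assume t: "t \<in> {0..a}"
    \<comment> \<open>The terminal value c cancels. Stating the identity for arbitrary reals keeps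
      the integrals opaque during simplification.\<close>
    have split: "e * (c - i + j) - e * (c - k + l) = e * ((j - l) - (i - k))" for e c i j k l :: real
      by (simp add: algebra_simps)
    have "w t - v t = exp (- lam * t) * ((?I \<alpha> w t - ?I \<beta> v t) - (?I \<alpha> w a - ?I \<beta> v a))"
      unfolding caputo_tempered_solution_rl[OF w t] caputo_tempered_solution_rl[OF v t]
      by (rule split)
    then have "\<bar>w t - v t\<bar> = exp (- lam * t) * \<bar>(?I \<alpha> w t - ?I \<beta> v t) - (?I \<alpha> w a - ?I \<beta> v a)\<bar>"
      by (simp only: abs_mult abs_exp_cancel)
    \<comment> \<open>The outer factor exp(-lam t) is at most 1, as lam and t are
      nonnegative.\<close>
    also have "\<dots> \<le> 1 * \<bar>(?I \<alpha> w t - ?I \<beta> v t) - (?I \<alpha> w a - ?I \<beta> v a)\<bar>"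
      using t \<open>0 \<le> lam\<close> by (intro mult_right_mono) auto
    also have "\<dots> \<le> 2 * ?B"
      using I[of a] I[OF t] \<open>0 < a\<close> by simp
    finally show "\<bar>w t - v t\<bar> \<le> 2 * ?B" .
  qed (use \<open>0 < a\<close> in auto)
  then show ?thesis
    by (simp add: algebra_simps)
qed

section \<open>Absorption of the difference for small \<delta>\<close>

theorem theorem5:
  fixes \<alpha> lam a y\<^sub>a L :: real
    and J :: "real set"
    and f :: "real \<Rightarrow> real \<Rightarrow> real"
    and y :: "real \<Rightarrow> real"
    and z :: "real \<Rightarrow> real \<Rightarrow> real"
  assumes "0 < \<alpha>" and "\<alpha> < 1"
    and "0 \<le> lam" and "0 < a"
    and "is_interval J"
    and "continuous_on ({0..a} \<times> J) (\<lambda>(t, u). f t u)"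
    and "\<And>t u v. t \<in> {0..a} \<Longrightarrow> u \<in> J \<Longrightarrow> v \<in> J \<Longrightarrow> \<bar>f t u - f t v\<bar> \<le> L * \<bar>u - v\<bar>"
    and "0 < L" and "L < Gamma (\<alpha> + 1) / (2 * a powr \<alpha> * exp (lam * a))"
    and "unique_caputo_tempered_solution \<alpha> lam a y\<^sub>a J f y"
    and "\<forall>\<^sub>F \<delta> in at_right 0. unique_caputo_tempered_solution (\<alpha> - \<delta>) lam a y\<^sub>a J f (z \<delta>)"
  shows "\<exists>C>0. \<exists>\<delta>\<^sub>0\<in>{0<..<\<alpha>}. \<forall>\<delta>\<in>{0<..<\<delta>\<^sub>0}. max_norm a (\<lambda>t. y t - z \<delta> t) \<le> C * \<delta>"
proof -
  have y: "caputo_tempered_solution \<alpha> lam a y\<^sub>a J f y"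
    using assms(10) by (simp add: unique_caputo_tempered_solution_def)
  \<comment> \<open>The bound M is taken along y before \<delta> is introduced, so it cannot depend
    on \<delta>.\<close>
  have "continuous_on {0..a} (\<lambda>s. (\<lambda>(t, u). f t u) (s, y s))"
    using y by (intro continuous_on_compose2[OF assms(6)] continuous_intros)
      (auto simp: caputo_tempered_solution_def)
  then have "bounded ((\<lambda>s. f s (y s)) ` {0..a})"
    by (intro compact_imp_bounded compact_continuous_image) auto
  then obtain M where M: "0 < M" "\<And>s. s \<in> {0..a} \<Longrightarrow> \<bar>f s (y s)\<bar> \<le> M"
    unfolding bounded_pos by auto
  obtain C where C: "0 \<le> C" "\<forall>\<^sub>F \<delta> in at_right 0.
      integral {0..a} (\<lambda>r. \<bar>rl_kernel \<alpha> r - rl_kernel (\<alpha> - \<delta>) r\<bar>) \<le> C * \<delta>"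
    using rl_kernel_diff_linear_bound[OF \<open>0 < \<alpha>\<close> \<open>0 < a\<close>] by auto
  define E where "E = exp (lam * a)"
  have "0 < E" by (simp add: E_def)
  define P where "P \<mu> = 2 * E * L * (a powr \<mu> * rGamma (\<mu> + 1))" for \<mu>
  \<comment> \<open>P \<mu> is the coefficient of the norm to be absorbed when the perturbed order
    is \<mu>. The upper bound assumed on L says exactly that P \<alpha> < 1.\<close>
  have "P \<alpha> < 1"
    using assms(9) \<open>0 < a\<close> \<open>0 < E\<close> Gamma_real_pos[of "\<alpha> + 1"] \<open>0 < \<alpha>\<close>
    unfolding P_def E_def[symmetric] by (simp add: rGamma_inverse_Gamma field_simps)
  \<comment> \<open>The gap between P \<alpha> and q leaves room for continuity in the order: P
    (\<alpha> - \<delta>) < q eventually, with 1 - q fixed and positive.\<close>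
  then obtain q where q: "P \<alpha> < q" "q < 1"
    using dense by blast
  have "((\<lambda>\<delta>. P (\<alpha> - \<delta>)) \<longlongrightarrow> P \<alpha>) (at_right 0)"
    unfolding P_def using \<open>0 < a\<close>
    by (intro tendsto_intros tendsto_minus_at_right_0 isCont_tendsto_compose[where g = rGamma] isCont_rGamma)
      auto
  then have "\<forall>\<^sub>F \<delta> in at_right 0. P (\<alpha> - \<delta>) < q"
    using q(1) by (rule order_tendstoD)
  moreover have "\<forall>\<^sub>F \<delta> in at_right 0. 0 < \<alpha> - \<delta>"
    using tendsto_minus_at_right_0 \<open>0 < \<alpha>\<close> by (rule order_tendstoD)
  \<comment> \<open>C is only known to be nonnegative; the summand 1 makes the final constant
    strictly positive.\<close>
  ultimately have "\<forall>\<^sub>F \<delta> in at_right 0. \<delta> < \<alpha> \<and>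
      max_norm a (\<lambda>t. y t - z \<delta> t) \<le> (2 * E * M * C / (1 - q) + 1) * \<delta>"
    using C(2) assms(11) eventually_at_right_less[of 0]
  proof eventually_elim
    case (elim \<delta>)
    let ?N = "max_norm a (\<lambda>t. y t - z \<delta> t)"
    have z: "caputo_tempered_solution (\<alpha> - \<delta>) lam a y\<^sub>a J f (z \<delta>)"
      using elim by (simp add: unique_caputo_tempered_solution_def)
    \<comment> \<open>Nonnegativity of \<open>?N\<close> is what allows P (\<alpha> - \<delta>) < q
      to be multiplied by it below.\<close>
    have "\<bar>y 0 - z \<delta> 0\<bar> \<le> ?N"
      using y z \<open>0 < a\<close> by (intro abs_le_max_norm[where g = "\<lambda>t. y t - z \<delta> t"] continuous_intros)
        (auto simp: caputo_tempered_solution_def)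
    then have "0 \<le> ?N" by linarith
    have "?N \<le> 2 * E * M * integral {0..a} (\<lambda>r. \<bar>rl_kernel \<alpha> r - rl_kernel (\<alpha> - \<delta>) r\<bar>) + P (\<alpha> - \<delta>) * ?N"
      unfolding P_def E_def
      using assms(1,3,4,6,7,8) elim(2) M(2) y z
      by (intro caputo_tempered_solution_max_norm_diff[where J = J and f = f]) auto
    also have "\<dots> \<le> 2 * E * M * (C * \<delta>) + q * ?N"
      using elim \<open>0 < E\<close> \<open>0 < M\<close> \<open>0 \<le> ?N\<close> by (intro add_mono mult_left_mono mult_right_mono) auto
    finally have "?N \<le> 2 * E * M * C / (1 - q) * \<delta>"
      using q(2) by (simp add: field_simps)
    then show ?case
      using elim by (simp add: algebra_simps)
  qed
  then obtain b where b: "0 < b" "\<And>\<delta>. 0 < \<delta> \<Longrightarrow> \<delta> < b \<Longrightarrow>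
      max_norm a (\<lambda>t. y t - z \<delta> t) \<le> (2 * E * M * C / (1 - q) + 1) * \<delta>"
    unfolding eventually_at_right_field by auto
  have "0 < 2 * E * M * C / (1 - q) + 1"
    using \<open>0 < E\<close> \<open>0 < M\<close> C(1) q(2) by (intro add_nonneg_pos) auto
  \<comment> \<open>Halving \<alpha> keeps the threshold strictly below \<alpha>, even if b is
    large.\<close>
  moreover have "min b (\<alpha> / 2) \<in> {0<..<\<alpha>}"
    using b(1) \<open>0 < \<alpha>\<close> by auto
  ultimately show ?thesis
    using b(2) by (intro exI[of _ "2 * E * M * C / (1 - q) + 1"] conjI bexI[of _ "min b (\<alpha> / 2)"]) auto
qed

end
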